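(* For every integer $d\ge 0$, the submodule $M_d$ of $\mathbb{C}[x,y]$ is indecomposable.
   Context: A submodule of $\mathbb{C}[x,y]$ is a translation invariant linear subspace of $\mathbb{C}[x,y]$; equivalently, a linear subspace closed under the partial derivatives $\partial/\partial x$ and $\partial/\partial y$. For an integer $d\ge 0$, $M_d=\{F\in\mathbb{C}[x,y]\colon \deg_x F<d\}$, where $\deg_x F$ is the degree of $F$ in the variable $x$ and the zero polynomial has degree $-\infty$; so $M_0=\{0\}$ and $M_1=\mathbb{C}[y]$. The sum of sets of polynomials is $A+B=\{f+g\colon f\in A, g\in B\}$. A submodule $M$ is decomposable if $M=A_1+\cdots+A_k$ for some $k\ge 1$ and some proper submodules $A_1,\ldots,A_k$ of $M$ (submodules of $\mathbb{C}[x,y]$ contained in $M$ and different from $M$). Otherwise $M$ is indecomposable. *)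

theory Defs
  imports
    Complex_Main
    "HOL-Computational_Algebra.Polynomial"
    "HOL-Library.Set_Algebras"
begin

text \<open>
  A polynomial in $x$ and $y$ is a polynomial in $x$ whose coefficients are polynomials in $y$,
  so \<open>degree\<close> is the degree in $x$ (except that \<open>degree 0 = 0\<close>).
\<close>

type_synonym bipoly = "complex poly poly"

definition bieval :: "bipoly \<Rightarrow> complex \<Rightarrow> complex \<Rightarrow> complex" where
  "bieval F x y = poly (poly F [:x:]) y"

definition translate :: "complex \<Rightarrow> complex \<Rightarrow> bipoly \<Rightarrow> bipoly" where
  "translate a b F = pcompose (map_poly (\<lambda>p. pcompose p [:b, 1:]) F) [:[:a:], 1:]"

lemma bieval_translate: "bieval (translate a b F) x y = bieval F (x + a) (y + b)"
proof -
  have "poly (poly (map_poly (\<lambda>p. pcompose p [:b, 1:]) F) [:c:]) y = poly (poly F [:c:]) (y + b)" for c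
    by (induction F) (simp_all add: map_poly_pCons poly_pcompose add.commute)
  then show ?thesis
    by (simp add: bieval_def translate_def poly_pcompose add.commute)
qed

interpretation bipoly: vector_space "\<lambda>c F :: bipoly. smult [:c:] F"
  by standard (simp_all add: smult_add_right smult_add_left [symmetric] mult.commute flip: one_pCons)

definition submodule :: "bipoly set \<Rightarrow> bool" where
  "submodule A \<longleftrightarrow> bipoly.subspace A \<and> (\<forall>a b. \<forall>F\<in>A. translate a b F \<in> A)"

text \<open>
  The sum of sets below is the iterated elementwise sum from \<^theory>\<open>HOL-Library.Set_Algebras\<close>.
\<close>

definition decomposable :: "bipoly set \<Rightarrow> bool" where
  "decomposable M \<longleftrightarrow> submodule M \<and>
     (\<exists>k::nat. k \<ge> 1 \<and> (\<exists>A :: nat \<Rightarrow> bipoly set.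
        (\<forall>i\<in>{1..k}. submodule (A i) \<and> A i \<subset> M) \<and> M = (\<Sum>i=1..k. A i)))"

definition indecomposable :: "bipoly set \<Rightarrow> bool" where
  "indecomposable M \<longleftrightarrow> submodule M \<and> \<not> decomposable M"

text \<open>The disjunct \<open>F = 0\<close> implements the convention that zero has degree $-\infty$.\<close>

definition M_sub :: "nat \<Rightarrow> bipoly set" where
  "M_sub d = {F. F = 0 \<or> degree F < d}"

lemma M_sub_0: "M_sub 0 = {0}"
  by (auto simp: M_sub_def)

lemma M_sub_1: "M_sub 1 = range (\<lambda>p. [:p:])"
  by (auto simp: M_sub_def elim: degree_eq_zeroE)

end

theory Submission
  imports Defs
begin

text \<open>
  For a submodule of \<open>M\<^sub>d\<^sub>+\<^sub>1\<close> look at the coefficients of $x^d$, which are polynomials in $y$.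
  The point is that a submodule $A$ is all of \<open>M\<^sub>d\<^sub>+\<^sub>1\<close> as soon as these coefficients have
  unbounded degree (lemma \<open>M_sub_subset_submodule\<close>).  A finite sum of proper submodules then
  has coefficients of bounded degree, so it misses $x^d y^N$ for large $N$.

  Finite differences do the work of derivatives here, since they are linear combinations of
  translations and also lower a degree by exactly one.  Differences in $y$, combined with
  subtracting multiples, show that the coefficients of $x^d$ run through all of $\mathbb{C}[y]$.
  A difference in $x$ multiplies the coefficient of $x^d$ by $d$ and moves it to $x^{d-1}$, so
  unboundedness passes on to $d - 1$, and induction on $d$ gives that $A$ contains
  \<open>M\<^sub>d\<close>.  Every element of \<open>M\<^sub>d\<^sub>+\<^sub>1\<close> agrees modulo \<open>M\<^sub>d\<close> with an element of $A$ having the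
  same coefficient of $x^d$, so $A$ contains \<open>M\<^sub>d\<^sub>+\<^sub>1\<close> too.  The case of \<open>M\<^sub>0\<close>, which has no
  proper submodule, is immediate.
\<close>

section \<open>Finite differences of univariate polynomials\<close>

text \<open>
  The binomial expansion of $p(x + a)$ in its two leading terms: the shift fixes the top
  coefficient, and the difference acts on it as $a$ times the derivative does.
\<close>

lemma coeff_pcompose_shift_eq:
  fixes p :: "'a::comm_ring_1 poly"
  assumes "degree p \<le> n"
  shows "coeff (pcompose p [:a, 1:]) n = coeff p n"
  using assms
proof (induction p arbitrary: n)
  case (pCons c p)
  show ?case
  proof (cases n)
    case 0
    with pCons.prems have "p = 0" by (auto split: if_splits)
    with 0 show ?thesis by (simp add: pcompose_pCons)
  next
    case (Suc m)
    with pCons.prems have m: "degree p \<le> m" by (auto split: if_splits)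
    then have "coeff (pcompose p [:a, 1:]) (Suc m) = coeff p (Suc m)"
      by (intro pCons.IH) simp
    with m have "coeff (pcompose p [:a, 1:]) (Suc m) = 0"
      by (simp add: coeff_eq_0)
    with pCons.IH[OF m] Suc show ?thesis
      by (simp add: pcompose_pCons coeff_pCons)
  qed
qed simp

lemma coeff_difference:
  fixes p :: "'a::comm_ring_1 poly"
  assumes "degree p \<le> Suc n"
  shows "coeff (pcompose p [:a, 1:] - p) n = of_nat (Suc n) * a * coeff p (Suc n)"
  using assms
proof (induction p arbitrary: n)
  case (pCons c p)
  from pCons.prems have n: "degree p \<le> n" by (auto split: if_splits)
  show ?case
  proof (cases n)
    case 0
    with coeff_pcompose_shift_eq[OF n, of a] show ?thesis
      by (simp add: pcompose_pCons)
  next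
    case (Suc m)
    have "coeff (pcompose p [:a, 1:]) m = coeff p m + of_nat n * a * coeff p n"
      using pCons.IH[of m] n Suc by (simp add: algebra_simps)
    with coeff_pcompose_shift_eq[OF n, of a] Suc show ?thesis
      by (simp add: pcompose_pCons coeff_pCons algebra_simps)
  qed
qed simp

lemma degree_difference_le:
  fixes p :: "'a::comm_ring_1 poly"
  assumes "degree p \<le> Suc n"
  shows "degree (pcompose p [:a, 1:] - p) \<le> n"
proof (rule degree_le, intro allI impI)
  fix i assume "i > n"
  with assms have "degree p \<le> i" by simp
  then show "coeff (pcompose p [:a, 1:] - p) i = 0"
    by (simp add: coeff_pcompose_shift_eq)
qed

text \<open>
  A space of polynomials of unbounded degree contains, by differencing, polynomials of every
  degree, and these are a basis.
\<close>

lemma shift_invariant_unbounded_degree_imp_all: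
  fixes L :: "'a::field_char_0 poly set"
  assumes zero: "0 \<in> L"
    and diff: "\<And>p q. p \<in> L \<Longrightarrow> q \<in> L \<Longrightarrow> p - q \<in> L"
    and smult: "\<And>c p. p \<in> L \<Longrightarrow> smult c p \<in> L"
    and shift: "\<And>p. p \<in> L \<Longrightarrow> pcompose p [:1, 1:] \<in> L"
    and unbounded: "\<And>n. \<exists>p\<in>L. n \<le> degree p"
  shows "p \<in> L"
proof -
  have lower: "\<exists>q\<in>L. degree q = n \<and> q \<noteq> 0" if "r \<in> L" "degree r = n + k" "r \<noteq> 0" for r n k
    using that
  proof (induction k arbitrary: r)
    case (Suc k)
    let ?s = "pcompose r [:1, 1:] - r"
    have "coeff ?s (n + k) = of_nat (Suc (n + k)) * lead_coeff r"
      using coeff_difference[of r "n + k" 1] Suc.prems(2) by simp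
    with Suc.prems(3) have nz: "coeff ?s (n + k) \<noteq> 0"
      by (simp del: of_nat_Suc)
    moreover have "degree ?s \<le> n + k"
      using Suc.prems(2) by (intro degree_difference_le) simp
    ultimately have "degree ?s = n + k"
      by (simp add: le_antisym le_degree)
    with nz show ?case
      using Suc.IH[of ?s] Suc.prems(1) diff shift by (metis coeff_0)
  qed auto
  have every: "\<exists>q\<in>L. degree q = n \<and> q \<noteq> 0" for n
  proof -
    obtain r where r: "r \<in> L" "Suc n \<le> degree r" using unbounded by blast
    then have "r \<noteq> 0" "degree r = n + (degree r - n)" by auto
    with r(1) lower show ?thesis by blast
  qed
  have "degree p < n \<Longrightarrow> p \<in> L" for n
  proof (induction n arbitrary: p)
    case (Suc n)
    obtain q where q: "q \<in> L" "degree q = n" "q \<noteq> 0" using every by blast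
    define c where "c = coeff p n / lead_coeff q"
    have q': "smult c q \<in> L" using q(1) smult by blast
    have "p - smult c q \<in> L"
    proof (cases "p - smult c q = 0")
      case False
      have le: "degree (p - smult c q) \<le> n"
        using Suc.prems q(2) by (intro degree_diff_le) auto
      have "coeff (p - smult c q) n = 0"
        using q(2,3) by (auto simp: c_def)
      with le False have "degree (p - smult c q) < n"
        using eq_zero_or_degree_less by blast
      then show ?thesis by (rule Suc.IH)
    qed (simp add: zero)
    from diff[OF this diff[OF zero q']] show ?case by simp
  qed simp
  then show ?thesis by blast
qed

section \<open>Translations and degrees in two variables\<close>

lemma translate_x: "translate a 0 F = pcompose F [:[:a:], 1:]"
  by (simp add: translate_def)

lemma coeff_translate_y: "coeff (translate 0 b F) i = pcompose (coeff F i) [:b, 1:]"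
  by (simp add: translate_def coeff_map_poly)

lemma degree_translate_le: "degree (translate a b F) \<le> degree F"
proof -
  have "degree (map_poly f F) \<le> degree F" if "f 0 = 0" for f :: "complex poly \<Rightarrow> complex poly"
    using that by (intro degree_le) (auto simp: coeff_map_poly coeff_eq_0)
  then show ?thesis
    by (simp add: translate_def degree_pcompose)
qed

lemma submodule_diff: "submodule A \<Longrightarrow> F \<in> A \<Longrightarrow> G \<in> A \<Longrightarrow> F - G \<in> A"
  by (simp add: submodule_def bipoly.subspace_diff)

lemma submodule_M_sub: "submodule (M_sub d)"
proof -
  have "bipoly.subspace (M_sub d)"
    by (auto simp: bipoly.subspace_def M_sub_def degree_add_less)
  moreover have "translate a b F \<in> M_sub d" if "F \<in> M_sub d" for a b F
    using that degree_translate_le[of a b F] by (auto simp: M_sub_def translate_def)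
  ultimately show ?thesis
    by (simp add: submodule_def)
qed

lemma M_sub_Suc: "F \<in> M_sub (Suc d) \<longleftrightarrow> degree F \<le> d"
  by (auto simp: M_sub_def)

section \<open>Submodules whose top coefficients have unbounded degree\<close>

text \<open>
  Modulo \<open>M\<^sub>d\<close> an element of \<open>M\<^sub>d\<^sub>+\<^sub>1\<close> is determined by its coefficient of $x^d$.  The set
  \<open>L\<close> of these coefficients inherits from the submodule the invariance under shifts of $y$.
\<close>

lemma M_sub_Suc_subset_submodule:
  assumes A: "submodule A"
    and unbounded: "\<And>n. \<exists>F\<in>A. degree F \<le> d \<and> n \<le> degree (coeff F d)"
    and lower: "M_sub d \<subseteq> A"
  shows "M_sub (Suc d) \<subseteq> A"
proof
  fix G assume "G \<in> M_sub (Suc d)"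
  then have G: "degree G \<le> d" by (simp add: M_sub_Suc)
  define L where "L = {coeff F d | F. F \<in> A \<and> degree F \<le> d}"
  have "coeff G d \<in> L"
  proof (rule shift_invariant_unbounded_degree_imp_all)
    show "0 \<in> L"
      using A bipoly.subspace_0 by (force simp: L_def submodule_def)
    show "p - q \<in> L" if pq: "p \<in> L" "q \<in> L" for p q
    proof -
      obtain F H where "p = coeff F d" "F \<in> A" "degree F \<le> d"
        and "q = coeff H d" "H \<in> A" "degree H \<le> d"
        using pq by (auto simp: L_def)
      then have "p - q = coeff (F - H) d" "F - H \<in> A" "degree (F - H) \<le> d"
        using A by (simp_all add: submodule_diff degree_diff_le)
      then show ?thesis unfolding L_def by blast
    qed
    show "smult c p \<in> L" if p: "p \<in> L" for c p
    proof -
      obtain F where F: "p = coeff F d" "F \<in> A" "degree F \<le> d"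
        using p by (auto simp: L_def)
      have "smult [:c:] F \<in> A"
        using A F(2) by (simp add: submodule_def bipoly.subspace_scale)
      moreover have "degree (smult [:c:] F) \<le> d"
        using degree_smult_le F(3) by (rule le_trans)
      moreover have "smult c p = coeff (smult [:c:] F) d"
        by (simp add: F(1))
      ultimately show ?thesis
        unfolding L_def by (intro CollectI exI[of _ "smult [:c:] F"] conjI)
    qed
    show "pcompose p [:1, 1:] \<in> L" if p: "p \<in> L" for p
    proof -
      obtain F where F: "p = coeff F d" "F \<in> A" "degree F \<le> d"
        using p by (auto simp: L_def)
      have "translate 0 1 F \<in> A"
        using A F(2) by (simp add: submodule_def)
      moreover have "degree (translate 0 1 F) \<le> d"
        using degree_translate_le F(3) by (rule le_trans)
      moreover have "pcompose p [:1, 1:] = coeff (translate 0 1 F) d"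
        by (simp add: F(1) coeff_translate_y)
      ultimately show ?thesis
        unfolding L_def by (intro CollectI exI[of _ "translate 0 1 F"] conjI)
    qed
    show "\<exists>p\<in>L. n \<le> degree p" for n
      using unbounded[of n] by (auto simp: L_def)
  qed
  then obtain F where F: "F \<in> A" "degree F \<le> d" "coeff F d = coeff G d"
    by (auto simp: L_def)
  have "degree (G - F) \<le> d"
    using F(2) G by (intro degree_diff_le) auto
  moreover have "coeff (G - F) d = 0"
    by (simp add: F(3))
  ultimately have "G - F \<in> M_sub d"
    unfolding M_sub_def using eq_zero_or_degree_less by blast
  with lower have "G - F \<in> A" by blast
  then have "(G - F) + F \<in> A"
    using A F(1) unfolding submodule_def by (blast intro: bipoly.subspace_add)
  then show "G \<in> A" by simp
qed

text \<open>
  The degree bound sits on the witnesses \<open>F\<close> instead of on $A$, so that the induction on $d$ can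
  keep the same submodule $A$ at every stage.
\<close>

lemma M_sub_subset_submodule:
  assumes A: "submodule A"
    and unbounded: "\<And>n. \<exists>F\<in>A. degree F \<le> d \<and> n \<le> degree (coeff F d)"
  shows "M_sub (Suc d) \<subseteq> A"
  using unbounded
proof (induction d)
  case 0
  have "M_sub 0 \<subseteq> A"
    using A by (simp add: M_sub_0 submodule_def bipoly.subspace_0)
  then show ?case
    by (rule M_sub_Suc_subset_submodule[OF A 0])
next
  case (Suc d)
  have "M_sub (Suc d) \<subseteq> A"
  proof (rule Suc.IH)
    fix n
    obtain F where F: "F \<in> A" "degree F \<le> Suc d" "n \<le> degree (coeff F (Suc d))"
      using Suc.prems by blast
    \<comment> \<open>The factor \<open>d + 1\<close> is a nonzero constant, so the new top coefficient has the same degree in $y$.\<close>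
    let ?G = "translate 1 0 F - F"
    have "?G \<in> A"
      using A F(1) by (simp add: submodule_diff submodule_def)
    moreover have "degree ?G \<le> d"
      using F(2) by (simp add: translate_x degree_difference_le)
    moreover have "coeff ?G d = of_nat (Suc d) * coeff F (Suc d)"
      using coeff_difference[OF F(2), of "[:1:]"] by (simp add: translate_x flip: one_pCons)
    then have "degree (coeff ?G d) = degree (coeff F (Suc d))"
      by (simp add: of_nat_poly del: of_nat_Suc)
    ultimately show "\<exists>G\<in>A. degree G \<le> d \<and> n \<le> degree (coeff G d)"
      using F(3) by metis
  qed
  then show ?case
    by (rule M_sub_Suc_subset_submodule[OF A Suc.prems])
qed

section \<open>Indecomposability\<close>

theorem theorem21:
  fixes d :: nat
  shows "indecomposable (M_sub d)"
proof -
  have False if k: "(k::nat) \<ge> 1"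
    and A: "\<And>i. i \<in> {1..k} \<Longrightarrow> submodule (A i) \<and> A i \<subset> M_sub d"
    and M: "M_sub d = (\<Sum>i=1..k. A i)" for k and A :: "nat \<Rightarrow> bipoly set"
  proof (cases d)
    case 0
    from k A[of 1] have "0 \<in> A 1" "A 1 \<subset> {0}"
      by (auto simp: 0 M_sub_0 submodule_def bipoly.subspace_0)
    then show False by blast
  next
    case (Suc e)
    have "\<exists>n. \<forall>F\<in>A i. degree (coeff F e) < n" if i: "i \<in> {1..k}" for i
    proof (rule ccontr)
      assume "\<nexists>n. \<forall>F\<in>A i. degree (coeff F e) < n"
      then have "\<exists>F\<in>A i. degree F \<le> e \<and> n \<le> degree (coeff F e)" for n
        using A[OF i] by (metis M_sub_Suc Suc leI psubsetD)
      with A[OF i] have "M_sub (Suc e) \<subseteq> A i"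
        by (intro M_sub_subset_submodule) auto
      with A[OF i] Suc show False by blast
    qed
    then obtain n where n: "degree (coeff F e) < n i" if "i \<in> {1..k}" "F \<in> A i" for i F
      by metis
    \<comment> \<open>The successor makes \<open>N\<close> positive, since even the zero polynomial has \<open>degree\<close> 0.\<close>
    define N where "N = Suc (\<Sum>i=1..k. n i)"
    have "monom (monom 1 N) e \<in> M_sub d"
      by (simp add: Suc M_sub_Suc degree_monom_le)
    then obtain f where f: "monom (monom 1 N) e = (\<Sum>i=1..k. f i)" "\<And>i. i \<in> {1..k} \<Longrightarrow> f i \<in> A i"
      by (auto simp: M set_sum_alt)
    have "degree (coeff (f i) e) < N" if "i \<in> {1..k}" for i
    proof -
      have "degree (coeff (f i) e) < n i" using n f(2) that by blast
      also have "n i \<le> (\<Sum>i=1..k. n i)" using that by (intro member_le_sum) auto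
      finally show ?thesis by (simp add: N_def)
    qed
    then have "degree (\<Sum>i=1..k. coeff (f i) e) < N"
      by (intro degree_sum_less) (auto simp: N_def)
    also have "(\<Sum>i=1..k. coeff (f i) e) = monom 1 N"
      using f(1) by (metis coeff_sum coeff_monom)
    finally show False by (simp add: degree_monom_eq)
  qed
  then show ?thesis
    unfolding indecomposable_def decomposable_def by (metis submodule_M_sub)
qed

end
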